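(* Fix $0<M_1<M_2$ and a radius $R>2M_2$. Set $R_1=R$, $R_2=R+L$ and let $L\downarrow0$. For all sufficiently small $L>0$ one has $a=R$. Moreover, as $L\downarrow0$, $$H_*=\frac1{R^2L}+O(1),\qquad \lambda_*=\frac{R^{3/2}}{\sqrt{R-2M_1}}\,\frac1L+O(1),$$ and the physical minimum $\frac{\Delta M}{2}\lambda_*=\frac{\Delta M}{2}\inf_{u\in\mathcal A_\infty}\mathcal I[u]$ satisfies $$\frac{\Delta M}{2}\lambda_*=\frac{\Delta M\,R^{3/2}}{2\sqrt{R-2M_1}}\,\frac1L+O(1).$$ In particular, the tangential NEC cost $\frac{\Delta M}{2}\inf_{\mathcal A_\infty}\mathcal I$ of a fixed mass increase $\Delta M$ across the annulus $[R,R+L]$ is unbounded as $L\downarrow0$.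
   Context: $\Delta M:=M_2-M_1$. For real $x$, $x_+=\max\{x,0\}$. $\mathcal A_\infty$: functions $u\in C^\infty(\mathbb R)$ with $u\ge0$, $\operatorname{supp}u\subset(R_1,R_2)$, $\int_{R_1}^{R_2}r^2u\,dr=1$. $P_u(r)=\int_{R_1}^r s^2u(s)\,ds$, $F_u(r)=1-\frac{2(M_1+\Delta M\,P_u(r))}{r}$, $\mathcal I[u]=\int_{R_1}^{R_2}\frac{r^3(u')_+}{\sqrt{F_u}}\,dr$; the tangential NEC cost of $u$ is $\frac{\Delta M}{2}\mathcal I[u]$. $A(r)=\frac{R_2^3-r^3}{3}$, $q(r)=\frac{r^{7/2}}{\sqrt{r-2M_1}}$, $\Psi=q/A$. $x_0$ is the unique real solution of $M_1x_0^3+3R_2^3x_0-7M_1R_2^3=0$. $a=\max\{R_1,x_0\}$, $\lambda_*=\Psi(a)$ (which equals $\inf_{\mathcal A_\infty}\mathcal I$), $H_*=1/A(a)=\frac{3}{R_2^3-a^3}$. *)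

theory Defs
  imports "HOL-Analysis.Analysis" "HOL-Library.Landau_Symbols"
begin

text \<open>Throughout, \<open>M1 < M2\<close> are the inner and outer masses and \<open>R1 < R2\<close> the radii of the annulus.\<close>

definition smooth :: "(real \<Rightarrow> real) \<Rightarrow> bool" where
  "smooth u \<longleftrightarrow> (\<forall>n x. (deriv ^^ n) u differentiable (at x))"

definition admissible :: "real \<Rightarrow> real \<Rightarrow> (real \<Rightarrow> real) set" where
  "admissible R1 R2 = {u. smooth u \<and> (\<forall>r. 0 \<le> u r) \<and>
     closure {r. u r \<noteq> 0} \<subseteq> {R1<..<R2} \<and> integral {R1..R2} (\<lambda>r. r^2 * u r) = 1}"

definition P_fun :: "real \<Rightarrow> (real \<Rightarrow> real) \<Rightarrow> real \<Rightarrow> real" where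
  "P_fun R1 u r = integral {R1..r} (\<lambda>s. s^2 * u s)"

definition F_fun :: "real \<Rightarrow> real \<Rightarrow> real \<Rightarrow> (real \<Rightarrow> real) \<Rightarrow> real \<Rightarrow> real" where
  "F_fun M1 M2 R1 u r = 1 - 2 * (M1 + (M2 - M1) * P_fun R1 u r) / r"

text \<open>The tangential NEC cost of \<open>u\<close> is \<open>(M2 - M1) / 2 * cost_integral M1 M2 R1 R2 u\<close>.\<close>

definition cost_integral :: "real \<Rightarrow> real \<Rightarrow> real \<Rightarrow> real \<Rightarrow> (real \<Rightarrow> real) \<Rightarrow> real" where
  "cost_integral M1 M2 R1 R2 u =
     integral {R1..R2} (\<lambda>r. r^3 * max (deriv u r) 0 / sqrt (F_fun M1 M2 R1 u r))"

definition A_fun :: "real \<Rightarrow> real \<Rightarrow> real" where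
  "A_fun R2 r = (R2^3 - r^3) / 3"

definition q_fun :: "real \<Rightarrow> real \<Rightarrow> real" where
  "q_fun M1 r = r powr (7/2) / sqrt (r - 2 * M1)"

definition Psi :: "real \<Rightarrow> real \<Rightarrow> real \<Rightarrow> real" where
  "Psi M1 R2 r = q_fun M1 r / A_fun R2 r"

text \<open>For \<open>M1 > 0\<close> and \<open>R2 > 0\<close> the cubic is strictly increasing, so it has exactly one real root.\<close>

definition x0 :: "real \<Rightarrow> real \<Rightarrow> real" where
  "x0 M1 R2 = (THE x. M1 * x^3 + 3 * R2^3 * x - 7 * M1 * R2^3 = 0)"

definition a_opt :: "real \<Rightarrow> real \<Rightarrow> real \<Rightarrow> real" where
  "a_opt M1 R1 R2 = max R1 (x0 M1 R2)"

definition lambda_star :: "real \<Rightarrow> real \<Rightarrow> real \<Rightarrow> real" where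
  "lambda_star M1 R1 R2 = Psi M1 R2 (a_opt M1 R1 R2)"

definition H_star :: "real \<Rightarrow> real \<Rightarrow> real \<Rightarrow> real" where
  "H_star M1 R1 R2 = 1 / A_fun R2 (a_opt M1 R1 R2)"

end

theory Submission
  imports Defs
begin

text \<open>Since \<open>0 \<le> P_fun\<close>, the weight \<open>r^3 / sqrt F\<close> dominates \<open>q_fun\<close>, and \<open>q_fun \<ge> c A_fun\<close> for
  \<open>c = inf Psi\<close>; integrating the mass constraint by parts to \<open>\<integral> A_fun u' = 1\<close> bounds the cost below by
  \<open>c\<close>. Smoothed indicator functions of \<open>[a, R2]\<close> with \<open>a\<close> the minimiser of \<open>Psi\<close> attain \<open>c\<close> in the limit.
  The sign of \<open>Psi'\<close> is that of the increasing cubic defining \<open>x0\<close>, which is positive at \<open>R\<close> for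
  small \<open>L\<close>; hence \<open>a = R\<close> there and the asymptotics are those of
  \<open>3 / ((R + L)^3 - R^3)\<close>.\<close>

section \<open>Smooth functions and a smooth step\<close>

text \<open>A family closed under differentiation contains every iterated derivative of each member.
  Smoothness proofs thereby reduce to naming such a family.\<close>

lemma smooth_coinduct:
  assumes "f \<in> D" and D: "\<And>f. f \<in> D \<Longrightarrow> \<exists>g\<in>D. \<forall>x. (f has_real_derivative g x) (at x)"
  shows "smooth f"
proof -
  have deriv: "deriv f \<in> D" if f: "f \<in> D" for f
  proof -
    obtain g where g: "g \<in> D" "\<forall>x. (f has_real_derivative g x) (at x)"
      using D[OF f] by blast
    then have "deriv f = g" by (auto intro: DERIV_imp_deriv)
    with g show ?thesis by simp
  qed
  have "(deriv ^^ n) f \<in> D" for n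
    by (induction n) (auto simp: assms(1) deriv)
  then show ?thesis
    unfolding smooth_def by (metis D real_differentiable_def)
qed

lemma smooth_deriv: "smooth f \<Longrightarrow> smooth (deriv f)"
  unfolding smooth_def by (metis funpow_Suc_right comp_apply)

lemma smooth_has_derivative:
  assumes "smooth f"
  shows "(f has_real_derivative deriv f x) (at x within A)"
proof -
  have "f differentiable (at x)"
    using assms unfolding smooth_def by (metis funpow_0)
  then show ?thesis
    by (meson DERIV_deriv_iff_real_differentiable has_field_derivative_at_within)
qed

lemma smooth_continuous_on: "smooth f \<Longrightarrow> continuous_on A f"
  by (meson DERIV_continuous_on smooth_has_derivative)

lemma smooth_antiderivative:
  assumes "\<And>x. (f has_real_derivative g x) (at x)" "smooth g"
  shows "smooth f"
proof (rule smooth_coinduct[where D = "insert f (Collect smooth)"])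
  fix h assume "h \<in> insert f (Collect smooth)"
  then consider "h = f" | "smooth h" by blast
  then show "\<exists>k\<in>insert f (Collect smooth). \<forall>x. (h has_real_derivative k x) (at x)"
  proof cases
    case 1
    then show ?thesis using assms by (intro bexI[of _ g]) auto
  next
    case 2
    then show ?thesis
      by (intro bexI[of _ "deriv h"]) (auto intro: smooth_deriv smooth_has_derivative)
  qed
qed simp

lemma smooth_const: "smooth (\<lambda>_. c)"
  by (rule smooth_coinduct[where D = "range (\<lambda>c _. c)"]) (auto intro!: derivative_eq_intros)

lemma smooth_add:
  assumes "smooth f" "smooth g"
  shows "smooth (\<lambda>x. f x + g x)"
proof (rule smooth_coinduct[where D = "{\<lambda>x. f x + g x | f g. smooth f \<and> smooth g}"])
  fix h :: "real \<Rightarrow> real"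
  assume "h \<in> {\<lambda>x. f x + g x | f g. smooth f \<and> smooth g}"
  then obtain f g where h: "h = (\<lambda>x. f x + g x)" "smooth f" "smooth g" by blast
  have "\<forall>x. (h has_real_derivative deriv f x + deriv g x) (at x)"
    unfolding h by (auto intro!: DERIV_add smooth_has_derivative h)
  with h smooth_deriv
  show "\<exists>k\<in>{\<lambda>x. f x + g x | f g. smooth f \<and> smooth g}. \<forall>x. (h has_real_derivative k x) (at x)"
    by (intro bexI[of _ "\<lambda>x. deriv f x + deriv g x"]) auto
qed (use assms in blast)

text \<open>Products alone are not closed under differentiation, because the Leibniz rule produces a
  sum of two of them; finite sums of products are.\<close>

inductive_set product_span :: "(real \<Rightarrow> real) set" where
  product: "smooth f \<Longrightarrow> smooth g \<Longrightarrow> (\<lambda>x. f x * g x) \<in> product_span"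
| sum: "h \<in> product_span \<Longrightarrow> k \<in> product_span \<Longrightarrow> (\<lambda>x. h x + k x) \<in> product_span"

lemma smooth_mult:
  assumes "smooth f" "smooth g"
  shows "smooth (\<lambda>x. f x * g x)"
proof (rule smooth_coinduct[where D = product_span])
  fix h assume "h \<in> product_span"
  then show "\<exists>k\<in>product_span. \<forall>x. (h has_real_derivative k x) (at x)"
  proof induction
    case (product f g)
    have "\<forall>x. ((\<lambda>x. f x * g x) has_real_derivative deriv f x * g x + deriv g x * f x) (at x)"
      by (auto intro!: DERIV_mult smooth_has_derivative product)
    then show ?case
      using product smooth_deriv product_span.intros by (metis (no_types, lifting))
  next
    case (sum h k)
    then obtain h' k' where hk: "h' \<in> product_span" "k' \<in> product_span"
      "\<forall>x. (h has_real_derivative h' x) (at x)" "\<forall>x. (k has_real_derivative k' x) (at x)"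
      by blast
    then show ?case
      by (intro bexI[of _ "\<lambda>x. h' x + k' x"]) (auto intro: DERIV_add product_span.sum)
  qed
qed (use assms product_span.product in blast)

lemma smooth_affine:
  assumes "smooth f"
  shows "smooth (\<lambda>x. f (b * x + c))"
proof (rule smooth_coinduct[where D = "{\<lambda>x. f (b * x + c) | f. smooth f}"])
  fix h :: "real \<Rightarrow> real"
  assume "h \<in> {\<lambda>x. f (b * x + c) | f. smooth f}"
  then obtain f where h: "h = (\<lambda>x. f (b * x + c))" "smooth f" by blast
  have "(h has_real_derivative b * deriv f (b * x + c)) (at x)" for x
  proof -
    have "((\<lambda>x. b * x + c) has_real_derivative b) (at x)"
      by (auto intro!: derivative_eq_intros)
    from DERIV_chain2[OF smooth_has_derivative[OF h(2)] this] show ?thesis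
      unfolding h by (simp add: mult.commute)
  qed
  \<comment> \<open>The chain rule factor \<open>b\<close> is absorbed into the outer function, so
    the derivative stays in the family.\<close>
  moreover have "smooth (\<lambda>x. b * deriv f x)"
    by (intro smooth_mult smooth_const smooth_deriv h)
  ultimately show "\<exists>k\<in>{\<lambda>x. f (b * x + c) | f. smooth f}. \<forall>x. (h has_real_derivative k x) (at x)"
    by (intro bexI[of _ "\<lambda>x. b * deriv f (b * x + c)"]) auto
qed (use assms in blast)

section \<open>Functions flat at the origin\<close>

lemma tendsto_poly_times_exp_neg: "((\<lambda>y::real. poly p y * exp (- y)) \<longlongrightarrow> 0) at_top"
proof -
  have "((\<lambda>y. \<Sum>i\<le>degree p. coeff p i * (y ^ i / exp y)) \<longlongrightarrow> (\<Sum>i\<le>degree p. coeff p i * 0)) at_top"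
    by (intro tendsto_intros tendsto_power_div_exp_0)
  then show ?thesis
    by (simp add: poly_altdef sum_divide_distrib exp_minus divide_inverse sum_distrib_right mult.assoc)
qed

text \<open>The classical \<open>exp (- 1 / x)\<close>, extended by zero. The polynomial in
  \<open>1 / x\<close> is carried along to make the family closed under differentiation: one
  derivative replaces \<open>p\<close> by \<open>X^2 (p - p')\<close>.\<close>

definition flat :: "real poly \<Rightarrow> real \<Rightarrow> real" where
  "flat p x = (if x > 0 then poly p (1 / x) * exp (- (1 / x)) else 0)"

lemma flat_has_derivative:
  "(flat p has_real_derivative flat ([:0, 0, 1:] * (p - pderiv p)) x) (at x)"
proof (cases x "0::real" rule: linorder_cases)
  case less
  have "((\<lambda>_. 0) has_real_derivative 0) (at x)" by simp
  moreover have "\<forall>\<^sub>F y in nhds x. (0::real) = flat p y"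
    using eventually_nhds_in_open[of "{..<0}" x] less
    by (auto elim!: eventually_mono simp: flat_def)
  ultimately show ?thesis
    using less DERIV_cong_ev[of x x "\<lambda>_. 0" "flat p" 0 0] by (simp add: flat_def)
next
  case greater
  let ?d = "poly ([:0, 0, 1:] * (p - pderiv p)) (1 / x) * exp (- (1 / x))"
  have D: "((\<lambda>x. poly p (1 / x) * exp (- (1 / x))) has_real_derivative ?d) (at x)"
    using greater
    by (auto intro!: derivative_eq_intros DERIV_chain2[OF poly_DERIV] simp: field_simps power2_eq_square)
  have "\<forall>\<^sub>F y in nhds x. poly p (1 / y) * exp (- (1 / y)) = flat p y"
    using eventually_nhds_in_open[of "{0<..}" x] greater
    by (auto elim!: eventually_mono simp: flat_def)
  then have "(flat p has_real_derivative ?d) (at x)"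
    using D by (rule DERIV_cong_ev[OF refl _ refl, THEN iffD1])
  moreover have "flat ([:0, 0, 1:] * (p - pderiv p)) x = ?d"
    using greater by (simp only: flat_def if_True)
  ultimately show ?thesis by (simp only:)
next
  case equal
  \<comment> \<open>Under \<open>y = 1 / h\<close> the right-hand difference quotient at 0 becomes
    \<open>y * poly p y * exp (- y)\<close>, which decays.\<close>
  have "((\<lambda>y. poly ([:0, 1:] * p) y * exp (- y)) \<longlongrightarrow> 0) at_top"
    by (rule tendsto_poly_times_exp_neg)
  then have "((\<lambda>h. poly ([:0, 1:] * p) (inverse h) * exp (- inverse h)) \<longlongrightarrow> 0) (at_right 0)"
    by (rule filterlim_compose[OF _ filterlim_inverse_at_top_right])
  then have "((\<lambda>h. flat p h / h) \<longlongrightarrow> 0) (at_right 0)"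
    by (rule Lim_transform_eventually)
      (auto simp: eventually_at_filter flat_def field_simps)
  moreover have "((\<lambda>h. flat p h / h) \<longlongrightarrow> 0) (at_left 0)"
    by (rule Lim_transform_eventually[of "\<lambda>_. 0"])
      (auto simp: eventually_at_filter flat_def)
  ultimately have "((\<lambda>h. flat p h / h) \<longlongrightarrow> 0) (at 0)"
    by (intro filterlim_split_at)
  then show ?thesis
    using equal by (simp add: DERIV_def flat_def)
qed

lemma smooth_flat: "smooth (flat p)"
proof (rule smooth_coinduct[where D = "range flat"])
  fix f assume "f \<in> range flat"
  then obtain p where "f = flat p" by blast
  then show "\<exists>g\<in>range flat. \<forall>x. (f has_real_derivative g x) (at x)"
    using flat_has_derivative[of p] by blast
qed simp

section \<open>The smooth step\<close>

lemma integral_eq_zeroI: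
  fixes f :: "real \<Rightarrow> real"
  assumes "\<And>x. x \<in> A \<Longrightarrow> f x = 0"
  shows "integral A f = 0"
  using integral_cong[of A f "\<lambda>_. 0"] assms by simp

definition smooth_step :: "(real \<Rightarrow> real) \<Rightarrow> bool" where
  "smooth_step S \<longleftrightarrow> smooth S \<and> (\<forall>x. 0 \<le> deriv S x) \<and> (\<forall>x\<le>0. S x = 0) \<and> (\<forall>x\<ge>1. S x = 1) \<and>
    (\<forall>x. deriv S x \<noteq> 0 \<longrightarrow> 0 < x \<and> x < 1)"

text \<open>The step is the normalised primitive of a smooth bump that is positive exactly on the
  open unit interval.\<close>

lemma smooth_step_exists: "\<exists>S. smooth_step S"
proof -
  define \<phi> where "\<phi> x = flat 1 x * flat 1 (- 1 * x + 1)" for x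
  have \<phi>: "smooth \<phi>"
    unfolding \<phi>_def by (intro smooth_mult smooth_flat smooth_affine)
  have nonneg: "0 \<le> \<phi> x" for x by (simp add: \<phi>_def flat_def)
  have zero: "\<phi> x = 0" if "\<not> (0 < x \<and> x < 1)" for x using that by (auto simp: \<phi>_def flat_def)
  have int: "\<phi> integrable_on {a..b}" for a b
    by (intro integrable_continuous_interval smooth_continuous_on \<phi>)
  \<comment> \<open>The base point lies strictly left of the bump, so every \<open>x >= 0\<close> is
    interior to \<open>{-1..x + 1}\<close> and the one-sided derivative of the integral is
    two-sided. Left of the base point the interval is empty and the value 0 is the right
    one.\<close>
  define T where "T x = integral {-1..x} \<phi>" for x
  have T0: "T x = 0" if "x \<le> 0" for x
    unfolding T_def using that zero by (intro integral_eq_zeroI) auto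
  have T': "(T has_real_derivative \<phi> x) (at x)" for x
  proof (cases "x < 0")
    case True
    have "((\<lambda>_. 0) has_real_derivative 0) (at x)" by simp
    moreover have "\<forall>\<^sub>F y in nhds x. (0::real) = T y"
      using eventually_nhds_in_open[of "{..<0}" x] True
      by (auto elim!: eventually_mono simp: T0)
    ultimately show ?thesis
      using True DERIV_cong_ev[of x x "\<lambda>_. 0" T 0 0] by (simp add: zero)
  next
    case False
    then have "(T has_real_derivative \<phi> x) (at x within {-1..x + 1})"
      unfolding T_def by (intro integral_has_real_derivative smooth_continuous_on \<phi>) auto
    moreover have "at x within {-1..x + 1} = at x"
      using False by (intro at_within_interior) auto
    ultimately show ?thesis by simp
  qed
  have T1: "T x = T 1" if "1 \<le> x" for x
  proof -
    have "integral {-1..1} \<phi> + integral {1..x} \<phi> = integral {-1..x} \<phi>"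
      using that by (intro Henstock_Kurzweil_Integration.integral_combine int) auto
    moreover have "integral {1..x} \<phi> = 0"
      using zero by (intro integral_eq_zeroI) auto
    ultimately show ?thesis by (simp add: T_def)
  qed
  have "T 1 \<noteq> 0"
  proof
    assume "T 1 = 0"
    then have "\<forall>x\<in>{-1..1}. \<phi> x = 0"
      unfolding T_def
      by (subst (asm) integral_eq_0_iff) (auto intro: smooth_continuous_on \<phi> nonneg)
    then have "\<phi> (1/2) = 0" by simp
    then show False by (simp add: \<phi>_def flat_def)
  qed
  moreover have "0 \<le> T 1"
    unfolding T_def by (intro integral_nonneg int nonneg)
  ultimately have pos: "0 < T 1" by simp
  define S where "S x = T x / T 1" for x
  have S': "(S has_real_derivative \<phi> x / T 1) (at x)" for x
    unfolding S_def by (intro DERIV_cdivide T')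
  have dS: "deriv S x = \<phi> x / T 1" for x using S' by (rule DERIV_imp_deriv)
  have "smooth (\<lambda>x. \<phi> x * (1 / T 1))" by (intro smooth_mult \<phi> smooth_const)
  then have "smooth S" using S' by (intro smooth_antiderivative[of S]) auto
  moreover have "S x = 0" if "x \<le> 0" for x using T0[OF that] by (simp add: S_def)
  moreover have "S x = 1" if "1 \<le> x" for x using T1[OF that] pos by (simp add: S_def)
  moreover have "0 \<le> deriv S x" for x using pos nonneg by (simp add: dS)
  moreover have "0 < x \<and> x < 1" if "deriv S x \<noteq> 0" for x using zero[of x] that by (auto simp: dS)
  ultimately show ?thesis unfolding smooth_step_def by blast
qed

section \<open>The minimum of Psi\<close>

text \<open>On \<open>2 * M1 < r < R2\<close> this is the derivative of \<open>ln Psi\<close> up to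
  a positive factor.\<close>

definition cubic :: "real \<Rightarrow> real \<Rightarrow> real \<Rightarrow> real" where
  "cubic M1 R2 x = M1 * x^3 + 3 * R2^3 * x - 7 * M1 * R2^3"

lemma cubic_strict_mono:
  assumes "0 < M1" "0 < R2" "x < y"
  shows "cubic M1 R2 x < cubic M1 R2 y"
proof -
  have "x ^ 3 \<le> y ^ 3" using assms(3) by (intro power_mono_odd) auto
  then have "M1 * x ^ 3 \<le> M1 * y ^ 3" using assms by simp
  moreover have "3 * R2 ^ 3 * x < 3 * R2 ^ 3 * y" using assms by simp
  ultimately show ?thesis unfolding cubic_def by linarith
qed

text \<open>The cubic is nonpositive at 0 and equals \<open>3 * R2^3 * (R2 - 2 * M1) > 0\<close> at
  \<open>R2\<close>, which gives a root between them. Strict monotonicity makes it unique, so the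
  definite description denotes it.\<close>

lemma x0_root:
  assumes "0 < M1" "2 * M1 < R2"
  shows "cubic M1 R2 (x0 M1 R2) = 0" "x0 M1 R2 < R2"
proof -
  have R2: "0 < R2" using assms by simp
  have end_pos: "0 < cubic M1 R2 R2"
  proof -
    have "cubic M1 R2 R2 = 3 * R2 ^ 3 * (R2 - 2 * M1)"
      unfolding cubic_def by algebra
    then show ?thesis using assms R2 by simp
  qed
  have "\<exists>x\<ge>0. x \<le> R2 \<and> cubic M1 R2 x = 0"
  proof (rule IVT')
    show "cubic M1 R2 0 \<le> 0" using assms R2 by (simp add: cubic_def)
    show "continuous_on {0..R2} (cubic M1 R2)"
      unfolding cubic_def by (intro continuous_intros)
  qed (use end_pos R2 in auto)
  then obtain x where x: "x \<le> R2" "cubic M1 R2 x = 0" by blast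
  have uniq: "y = x" if "cubic M1 R2 y = 0" for y
    using cubic_strict_mono[OF assms(1) R2] x that by (metis linorder_neqE_linordered_idom order_less_irrefl)
  have "x0 M1 R2 = x"
    unfolding x0_def cubic_def[symmetric] using x(2) uniq by (rule the_equality)
  moreover have "x \<noteq> R2" using x end_pos by force
  ultimately show "cubic M1 R2 (x0 M1 R2) = 0" "x0 M1 R2 < R2"
    using x by simp_all
qed

text \<open>Comparison with the implicit root becomes the sign of an explicit polynomial. This
  serves both the monotonicity of \<open>Psi\<close> and the limit of thin annuli.\<close>

lemma x0_le_iff:
  assumes "0 < M1" "2 * M1 < R2"
  shows "x0 M1 R2 \<le> x \<longleftrightarrow> 0 \<le> cubic M1 R2 x"
proof -
  have "0 < R2" using assms by simp
  note mono = cubic_strict_mono[OF assms(1) this]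
  show ?thesis
    using mono[of x "x0 M1 R2"] mono[of "x0 M1 R2" x] x0_root(1)[OF assms]
    by (cases x "x0 M1 R2" rule: linorder_cases) auto
qed

text \<open>The logarithm turns the half-integer power and the square root in \<open>Psi\<close>
  into terms with rational derivatives.\<close>

definition log_Psi :: "real \<Rightarrow> real \<Rightarrow> real \<Rightarrow> real" where
  "log_Psi M1 R2 r = 7/2 * ln r - ln (r - 2 * M1) / 2 - ln (A_fun R2 r)"

lemma A_fun_pos: "0 < r \<Longrightarrow> r < R2 \<Longrightarrow> 0 < A_fun R2 r"
  unfolding A_fun_def using power_strict_mono[of r R2 3] by simp

lemma Psi_eq_exp:
  assumes "0 < M1" "2 * M1 < r" "r < R2"
  shows "Psi M1 R2 r = exp (log_Psi M1 R2 r)"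
proof -
  have "exp (ln (r - 2 * M1) / 2) = sqrt (r - 2 * M1)"
    using assms by (simp add: powr_half_sqrt[symmetric] powr_def)
  moreover have "exp (7/2 * ln r) = r powr (7/2)"
    using assms by (simp add: powr_def)
  ultimately show ?thesis
    using assms A_fun_pos[of r R2] by (simp add: log_Psi_def Psi_def q_fun_def exp_diff)
qed

text \<open>The first two logarithms contribute \<open>(3 r - 7 M1) / (r (r - 2 M1))\<close>. Over
  the common denominator with the third, the quartic terms cancel and the cubic remains.\<close>

lemma log_Psi_has_derivative:
  assumes "0 < M1" "2 * M1 < r" "r < R2"
  shows "(log_Psi M1 R2 has_real_derivative
    cubic M1 R2 r / (r * (r - 2 * M1) * (R2^3 - r^3))) (at r)"
proof -
  have r: "0 < r" "0 < A_fun R2 r" using assms A_fun_pos by auto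
  then have c: "0 < R2 ^ 3 - r ^ 3" by (simp add: A_fun_def)
  have "(A_fun R2 has_real_derivative - (r ^ 2)) (at r)"
    unfolding A_fun_def by (auto intro!: derivative_eq_intros)
  then have "(log_Psi M1 R2 has_real_derivative
      7/2 * (1 / r) - 1 / (r - 2 * M1) / 2 - - (r ^ 2) / A_fun R2 r) (at r)"
    unfolding log_Psi_def using assms r
    by (auto intro!: derivative_eq_intros) (simp add: divide_simps)
  moreover have "7/2 * (1 / r) - 1 / (r - 2 * M1) / 2 - - (r ^ 2) / A_fun R2 r =
      cubic M1 R2 r / (r * (r - 2 * M1) * (R2^3 - r^3))"
  proof -
    have "r - 2 * M1 \<noteq> 0" "r \<noteq> 0" "R2 ^ 3 - r ^ 3 \<noteq> 0" using assms r c by auto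
    then show ?thesis
      unfolding A_fun_def cubic_def
      by (simp add: divide_simps) algebra
  qed
  ultimately show ?thesis by simp
qed

text \<open>\<open>Psi\<close> falls up to \<open>x0\<close> and rises afterwards, so its minimum
  over \<open>R1 <= r < R2\<close> sits at \<open>x0\<close>, or at \<open>R1\<close> if
  \<open>x0\<close> lies to the left of it.\<close>

lemma Psi_a_opt_le:
  assumes "0 < M1" "2 * M1 < R1" "R1 \<le> r" "r < R2"
  shows "Psi M1 R2 (a_opt M1 R1 R2) \<le> Psi M1 R2 r"
proof -
  let ?a = "a_opt M1 R1 R2"
  have R2: "2 * M1 < R2" using assms by simp
  have a: "R1 \<le> ?a" "?a < R2" using x0_root[OF assms(1) R2] assms by (auto simp: a_opt_def)
  have D: "\<exists>d. (log_Psi M1 R2 has_real_derivative d) (at x) \<and> (0 \<le> d \<longleftrightarrow> x0 M1 R2 \<le> x) \<and> (x \<le> x0 M1 R2 \<longrightarrow> d \<le> 0)"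
    if x: "R1 \<le> x" "x < R2" for x
  proof (intro exI conjI)
    show "(log_Psi M1 R2 has_real_derivative
        cubic M1 R2 x / (x * (x - 2 * M1) * (R2^3 - x^3))) (at x)"
      using assms x by (intro log_Psi_has_derivative) auto
    have "0 < x * (x - 2 * M1) * (R2^3 - x^3)"
      using assms x power_strict_mono[of x R2 3] by simp
    then show "0 \<le> cubic M1 R2 x / (x * (x - 2 * M1) * (R2^3 - x^3)) \<longleftrightarrow> x0 M1 R2 \<le> x"
      "x \<le> x0 M1 R2 \<longrightarrow> cubic M1 R2 x / (x * (x - 2 * M1) * (R2^3 - x^3)) \<le> 0"
      using x0_le_iff[OF assms(1) R2, of x] x0_root[OF assms(1) R2]
      by (auto simp: zero_le_divide_iff divide_le_0_iff)
  qed
  have "log_Psi M1 R2 ?a \<le> log_Psi M1 R2 r"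
  proof (cases "?a \<le> r")
    case True
    have "\<exists>d. (log_Psi M1 R2 has_real_derivative d) (at x) \<and> 0 \<le> d" if "?a \<le> x" "x \<le> r" for x
      using D[of x] that a assms by (auto simp: a_opt_def)
    then show ?thesis by (rule DERIV_nonneg_imp_nondecreasing[OF True])
  next
    case False
    have "\<exists>d. (log_Psi M1 R2 has_real_derivative d) (at x) \<and> d \<le> 0" if "r \<le> x" "x \<le> ?a" for x
    proof -
      \<comment> \<open>Here \<open>R1 <= r < ?a\<close>, so the maximum defining \<open>?a\<close>
        is attained by \<open>x0\<close>.\<close>
      have "x \<le> x0 M1 R2" using that False assms(3) by (simp add: a_opt_def max_def split: if_splits)
      moreover have "R1 \<le> x" "x < R2" using that a assms(3) by linarith+
      ultimately show ?thesis using D[of x] by blast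
    qed
    moreover have "r \<le> ?a" using False by simp
    ultimately show ?thesis by (rule DERIV_nonpos_imp_nonincreasing[rotated])
  qed
  then show ?thesis
    using Psi_eq_exp[of M1 r R2] Psi_eq_exp[of M1 ?a R2] a assms by simp
qed

section \<open>The infimum of the cost\<close>

text \<open>The condition \<open>2 * M2 < R1\<close> keeps F positive even where the whole mass
  increase is enclosed.\<close>

locale annulus =
  fixes M1 M2 R1 R2 :: real
  assumes M1_pos: "0 < M1" and M1_less: "M1 < M2" and R1_gt: "2 * M2 < R1" and R1_less: "R1 < R2"
begin

section \<open>Enclosed mass and positivity of F\<close>

lemma radius_pos: "0 < R1" "2 * M1 < R1" using M1_pos M1_less R1_gt by auto

lemma admissible_endpoints:
  assumes "u \<in> admissible R1 R2"
  shows "u R1 = 0" "u R2 = 0"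
  using assms closure_subset[of "{r. u r \<noteq> 0}"] unfolding admissible_def by auto

lemma mass_integrable:
  assumes "smooth u"
  shows "(\<lambda>s. s^2 * u s) integrable_on {a..b}"
  by (intro integrable_continuous_interval continuous_intros smooth_continuous_on assms)

lemma P_fun_mono:
  assumes "u \<in> admissible R1 R2" "r \<le> s"
  shows "P_fun R1 u r \<le> P_fun R1 u s"
  unfolding P_fun_def using assms
  by (intro integral_subset_le mass_integrable) (auto simp: admissible_def)

lemma P_fun_bounds:
  assumes u: "u \<in> admissible R1 R2" and r: "R1 \<le> r" "r \<le> R2"
  shows "0 \<le> P_fun R1 u r" "P_fun R1 u r \<le> 1"
  using P_fun_mono[OF u r(1)] P_fun_mono[OF u r(2)] u
  by (auto simp: P_fun_def admissible_def)

lemma F_fun_pos: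
  assumes "u \<in> admissible R1 R2" "R1 \<le> r" "r \<le> R2"
  shows "0 < F_fun M1 M2 R1 u r"
proof -
  have "(M2 - M1) * P_fun R1 u r \<le> M2 - M1"
    using P_fun_bounds[OF assms] M1_less mult_left_mono[of "P_fun R1 u r" 1 "M2 - M1"] by simp
  then have "2 * (M1 + (M2 - M1) * P_fun R1 u r) < r"
    using R1_gt assms(2) unfolding distrib_left by linarith
  then show ?thesis using radius_pos assms by (simp add: F_fun_def)
qed

text \<open>Continuity gives integrability, so \<open>cost_integral\<close> is a true integral and
  not the default value for non-integrable functions.\<close>

lemma cost_integrand_continuous:
  assumes "u \<in> admissible R1 R2"
  shows "continuous_on {R1..R2} (\<lambda>r. r^3 * max (deriv u r) 0 / sqrt (F_fun M1 M2 R1 u r))"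
proof -
  have u: "smooth u" using assms by (simp add: admissible_def)
  have "continuous_on {R1..R2} (P_fun R1 u)"
    unfolding P_fun_def by (intro indefinite_integral_continuous_1 mass_integrable u)
  then have "continuous_on {R1..R2} (F_fun M1 M2 R1 u)"
    unfolding F_fun_def using radius_pos by (intro continuous_intros) auto
  moreover have "continuous_on {R1..R2} (deriv u)"
    by (intro smooth_continuous_on smooth_deriv u)
  moreover have "sqrt (F_fun M1 M2 R1 u r) \<noteq> 0" if "r \<in> {R1..R2}" for r
    using F_fun_pos[OF assms, of r] that by auto
  ultimately show ?thesis
    by (intro continuous_intros) auto
qed

section \<open>The lower bound\<close>

lemma A_fun_has_derivative: "(A_fun R2 has_real_derivative - (r ^ 2)) (at r within X)"
  unfolding A_fun_def by (auto intro!: derivative_eq_intros)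

text \<open>The mass constraint integrated by parts: \<open>- A_fun R2\<close> is a primitive of
  \<open>r^2\<close>, and the boundary terms vanish with \<open>u\<close> at both ends. The
  constraint is now linear in \<open>u'\<close>, the quantity the cost measures.\<close>

lemma A_fun_deriv_integral:
  assumes "u \<in> admissible R1 R2"
  shows "((\<lambda>r. A_fun R2 r * deriv u r) has_integral 1) {R1..R2}"
proof -
  have u: "smooth u" using assms by (simp add: admissible_def)
  have "((\<lambda>r. A_fun R2 r * deriv u r - r^2 * u r) has_integral
      A_fun R2 R2 * u R2 - A_fun R2 R1 * u R1) {R1..R2}"
  proof (rule fundamental_theorem_of_calculus)
    fix r
    show "((\<lambda>r. A_fun R2 r * u r) has_vector_derivative A_fun R2 r * deriv u r - r^2 * u r)
        (at r within {R1..R2})"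
      using DERIV_mult[OF A_fun_has_derivative smooth_has_derivative[OF u], of r "{R1..R2}"]
      by (simp add: has_real_derivative_iff_has_vector_derivative[symmetric] algebra_simps)
  qed (use R1_less in simp)
  moreover have "((\<lambda>r. r^2 * u r) has_integral 1) {R1..R2}"
    using assms mass_integrable[OF u] by (simp add: admissible_def has_integral_iff)
  ultimately have "((\<lambda>r. (A_fun R2 r * deriv u r - r^2 * u r) + r^2 * u r) has_integral 0 + 1) {R1..R2}"
    by (intro has_integral_add) (simp_all add: admissible_endpoints[OF assms])
  then show ?thesis by simp
qed

text \<open>This identifies \<open>q_fun\<close> as the weight of the cost at a radius that encloses
  none of the added mass.\<close>

lemma q_fun_eq:
  assumes "R1 \<le> r"
  shows "q_fun M1 r = r^3 / sqrt (1 - 2 * M1 / r)"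
proof -
  have r: "0 < r" "2 * M1 < r" using radius_pos assms by auto
  have "r powr (7/2) = r powr 3 * r powr (1/2)" by (simp flip: powr_add)
  also have "\<dots> = r^3 * sqrt r"
    using r by (simp add: powr_half_sqrt)
  finally have "r powr (7/2) = r^3 * sqrt r" .
  moreover have "sqrt (1 - 2 * M1 / r) = sqrt (r - 2 * M1) / sqrt r"
    using r by (simp add: real_sqrt_divide[symmetric] diff_divide_distrib)
  ultimately show ?thesis using r by (simp add: q_fun_def)
qed

lemma q_fun_le:
  assumes "u \<in> admissible R1 R2" "R1 \<le> r" "r \<le> R2"
  shows "q_fun M1 r \<le> r^3 / sqrt (F_fun M1 M2 R1 u r)"
proof -
  have "0 \<le> (M2 - M1) * P_fun R1 u r"
    using P_fun_bounds[OF assms] M1_less by simp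
  then have "F_fun M1 M2 R1 u r \<le> 1 - 2 * M1 / r"
    using radius_pos assms by (simp add: F_fun_def divide_right_mono)
  then show ?thesis
    unfolding q_fun_eq[OF assms(2)] using F_fun_pos[OF assms] radius_pos assms
    by (intro divide_left_mono) auto
qed

lemma cost_integral_ge:
  assumes u: "u \<in> admissible R1 R2" and "0 \<le> c"
    and c: "\<And>r. R1 \<le> r \<Longrightarrow> r < R2 \<Longrightarrow> c \<le> Psi M1 R2 r"
  shows "c \<le> cost_integral M1 M2 R1 R2 u"
proof -
  have "((\<lambda>r. c * (A_fun R2 r * deriv u r)) has_integral c * 1) {R1..R2}"
    by (intro has_integral_mult_right A_fun_deriv_integral u)
  moreover have "((\<lambda>r. r^3 * max (deriv u r) 0 / sqrt (F_fun M1 M2 R1 u r)) has_integral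
      cost_integral M1 M2 R1 R2 u) {R1..R2}"
    unfolding cost_integral_def
    by (intro integrable_integral integrable_continuous_interval cost_integrand_continuous u)
  ultimately have "c * 1 \<le> cost_integral M1 M2 R1 R2 u"
  proof (rule has_integral_le)
    fix r assume r: "r \<in> {R1..R2}"
    have A: "0 \<le> A_fun R2 r"
      using r radius_pos power_mono[of r R2 3] by (simp add: A_fun_def)
    \<comment> \<open>The hypothesis on \<open>Psi\<close> stops short of \<open>R2\<close>, where
      its denominator vanishes; there the inequality reads \<open>0 <= q_fun M1 R2\<close>.\<close>
    have "c * A_fun R2 r \<le> q_fun M1 r"
    proof (cases "r = R2")
      case True
      then show ?thesis using radius_pos r by (simp add: A_fun_def q_fun_def)
    next
      case False
      then show ?thesis
        using r c[of r] A_fun_pos[of r R2] radius_pos by (simp add: Psi_def pos_le_divide_eq)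
    qed
    also have "\<dots> \<le> r^3 / sqrt (F_fun M1 M2 R1 u r)"
      using q_fun_le[OF u] r by simp
    finally have le: "c * A_fun R2 r \<le> r^3 / sqrt (F_fun M1 M2 R1 u r)" .
    \<comment> \<open>The factor \<open>c * A_fun R2 r\<close> is nonnegative, so \<open>u'\<close>
      may first be replaced by its positive part; comparing the weights is then multiplication by a
      nonnegative number.\<close>
    have "c * (A_fun R2 r * deriv u r) \<le> c * A_fun R2 r * max (deriv u r) 0"
      using A \<open>0 \<le> c\<close> by (simp add: mult.assoc mult_left_mono)
    also have "\<dots> \<le> r^3 / sqrt (F_fun M1 M2 R1 u r) * max (deriv u r) 0"
      by (intro mult_right_mono le) simp
    finally show "c * (A_fun R2 r * deriv u r) \<le> r^3 * max (deriv u r) 0 / sqrt (F_fun M1 M2 R1 u r)"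
      by simp
  qed
  then show ?thesis by simp
qed

section \<open>The upper bound by competitors\<close>

definition height_bound :: "real \<Rightarrow> real \<Rightarrow> real" where
  "height_bound a e = 1 / (A_fun R2 (a + 2 * e) - A_fun R2 (R2 - 2 * e))"

text \<open>The competitor is at most \<open>height_bound a e\<close> high, the height at which the
  plateau \<open>[a + 2 e, R2 - 2 e]\<close> alone would carry unit mass. During a rise of width
  \<open>e\<close> it thus encloses at most \<open>e * (R2^2 * height_bound a e)\<close>. Inserting
  this mass and the smaller radius \<open>a\<close> bounds F from below there.\<close>

definition F_lower :: "real \<Rightarrow> real \<Rightarrow> real" where
  "F_lower a e = 1 - 2 * (M1 + (M2 - M1) * (e * (R2^2 * height_bound a e))) / a"

text \<open>The competitor rises from 0 to its plateau within \<open>[a + e, a + 2 e]\<close> and descends within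
  \<open>[R2 - 2 e, R2 - e]\<close>, so its cost is concentrated near \<open>a\<close>, where hardly any mass is enclosed.\<close>

lemma competitor:
  assumes a: "R1 \<le> a" and e: "0 < e" "a + 2 * e < R2 - 2 * e" and F: "0 < F_lower a e"
  obtains u where "u \<in> admissible R1 R2"
    "cost_integral M1 M2 R1 R2 u \<le> (a + 2 * e)^3 / sqrt (F_lower a e) * height_bound a e"
proof -
  obtain S where "smooth_step S" using smooth_step_exists by blast
  then have S: "smooth S" "\<And>x. 0 \<le> deriv S x" "\<And>x. x \<le> 0 \<Longrightarrow> S x = 0"
    "\<And>x. 1 \<le> x \<Longrightarrow> S x = 1" "\<And>x. deriv S x \<noteq> 0 \<Longrightarrow> 0 < x \<and> x < 1"
    unfolding smooth_step_def by blast+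
  have S_mono: "S x \<le> S y" if "x \<le> y" for x y
    by (rule DERIV_nonneg_imp_nondecreasing[OF that]) (use S(2) smooth_has_derivative[OF S(1)] in blast)
  have S_bounds: "0 \<le> S x" "S x \<le> 1" for x
    using S_mono[of "min x 0" x] S_mono[of x "max x 1"] S(3)[of "min x 0"] S(4)[of "max x 1"] by auto
  \<comment> \<open>The rise starts at \<open>b\<close> and the descent at \<open>c\<close>. The
    margins of length \<open>e\<close> keep the closed support inside the open annulus even when
    \<open>a = R1\<close>.\<close>
  define b c where "b = a + e" and "c = R2 - 2 * e"
  have bc: "R1 < b" "b + e < c" "c + e < R2" using a e by (auto simp: b_def c_def)
  define w where "w r = S ((r - b) / e) - S ((r - c) / e)" for r
  have step: "smooth (\<lambda>r. S ((r - t) / e))" for t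
    using smooth_affine[OF S(1), of "1 / e" "- t / e"] by (simp add: diff_divide_distrib)
  have step': "((\<lambda>r. S ((r - t) / e)) has_real_derivative deriv S ((r - t) / e) / e) (at r within X)" for t r X
  proof -
    have "((\<lambda>r. (r - t) / e) has_real_derivative 1 / e) (at r within X)"
      using e by (auto intro!: derivative_eq_intros)
    from DERIV_chain2[OF smooth_has_derivative[OF S(1)] this] show ?thesis by simp
  qed
  have w_smooth: "smooth w"
    using smooth_add[OF step[of b] smooth_mult[OF smooth_const[of "-1"] step[of c]]]
    by (simp add: w_def[abs_def])
  have w_bounds: "0 \<le> w r" "w r \<le> 1" for r
    using S_mono[of "(r - c) / e" "(r - b) / e"] S_bounds(1)[of "(r - c) / e"] S_bounds(2)[of "(r - b) / e"] bc e
    by (auto simp: w_def divide_right_mono)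
  have w_zero: "w r = 0" if "r \<le> b \<or> c + e \<le> r" for r
    using that bc e S(3,4) by (auto simp: w_def divide_le_0_iff le_divide_eq)
  have w_one: "w r = 1" if "b + e \<le> r" "r \<le> c" for r
    using that bc e S(3)[of "(r - c) / e"] S(4)[of "(r - b) / e"]
    by (auto simp: w_def divide_le_0_iff le_divide_eq)
  define m where "m = integral {R1..R2} (\<lambda>r. r^2 * w r)"
  define h where "h = 1 / m"
  \<comment> \<open>This difference is the integral of \<open>r^2\<close> over the plateau, hence a
    lower bound for the mass \<open>m\<close> of the profile of height 1.\<close>
  have gap: "0 < A_fun R2 (b + e) - A_fun R2 c"
    using bc e radius_pos power_strict_mono[of "b + e" c 3] by (simp add: A_fun_def)
  have "((\<lambda>r. r^2) has_integral - A_fun R2 c - - A_fun R2 (b + e)) {b + e..c}"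
    by (rule fundamental_theorem_of_calculus)
      (use bc DERIV_minus[OF A_fun_has_derivative] in
        \<open>auto simp: has_real_derivative_iff_has_vector_derivative[symmetric]\<close>)
  then have "integral {b + e..c} (\<lambda>r. r^2 * w r) = A_fun R2 (b + e) - A_fun R2 c"
    using w_one by (subst integral_cong[of _ _ "\<lambda>r. r^2"]) (auto simp: has_integral_iff)
  moreover have "integral {b + e..c} (\<lambda>r. r^2 * w r) \<le> m"
    unfolding m_def using bc e w_bounds by (intro integral_subset_le mass_integrable w_smooth) auto
  ultimately have m: "A_fun R2 (b + e) - A_fun R2 c \<le> m" by simp
  have h: "0 < h" "h \<le> height_bound a e"
    using m gap e by (auto simp: h_def height_bound_def b_def c_def frac_le add.assoc)
  define u where "u r = h * w r" for r
  have u_smooth: "smooth u"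
    unfolding u_def by (intro smooth_mult smooth_const w_smooth)
  have "{r. u r \<noteq> 0} \<subseteq> {b..c + e}"
  proof
    fix r assume "r \<in> {r. u r \<noteq> 0}"
    then have "\<not> (r \<le> b \<or> c + e \<le> r)" using w_zero[of r] by (auto simp: u_def)
    then show "r \<in> {b..c + e}" by simp
  qed
  then have "closure {r. u r \<noteq> 0} \<subseteq> {b..c + e}"
    by (rule closure_minimal) simp
  also have "\<dots> \<subseteq> {R1<..<R2}" using bc by auto
  finally have "closure {r. u r \<noteq> 0} \<subseteq> {R1<..<R2}" .
  moreover have "integral {R1..R2} (\<lambda>r. r^2 * u r) = h * m"
    unfolding m_def u_def by (subst integral_mult_right[symmetric]) (simp add: mult.left_commute)
  ultimately have u: "u \<in> admissible R1 R2"
    using u_smooth h w_bounds m gap by (auto simp: admissible_def u_def h_def)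
  have u': "deriv u r = h * (deriv S ((r - b) / e) / e - deriv S ((r - c) / e) / e)" for r
    unfolding u_def w_def by (intro DERIV_imp_deriv DERIV_cmult DERIV_diff step')
  define K where "K = (a + 2 * e)^3 / sqrt (F_lower a e)"
  have K: "0 \<le> K" unfolding K_def using a e radius_pos F by simp
  \<comment> \<open>Nothing is enclosed before \<open>b\<close>; on the rise the mass density is at
    most \<open>R2^2 * height_bound a e\<close> over a length of at most \<open>e\<close>.\<close>
  have F_ge: "F_lower a e \<le> F_fun M1 M2 R1 u r" if r: "b \<le> r" "r \<le> b + e" for r
  proof -
    have "integral {R1..b} (\<lambda>s. s^2 * u s) + integral {b..r} (\<lambda>s. s^2 * u s) = P_fun R1 u r"
      unfolding P_fun_def using bc r
      by (intro Henstock_Kurzweil_Integration.integral_combine mass_integrable u_smooth) auto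
    moreover have "integral {R1..b} (\<lambda>s. s^2 * u s) = 0"
      by (rule integral_eq_zeroI) (simp add: u_def w_zero)
    moreover have "integral {b..r} (\<lambda>s. s^2 * u s) \<le> integral {b..r} (\<lambda>_. R2^2 * height_bound a e)"
    proof (intro integral_le mass_integrable u_smooth)
      fix s assume s: "s \<in> {b..r}"
      have "s^2 \<le> R2^2" using s r bc radius_pos by (intro power_mono) auto
      moreover have "u s \<le> height_bound a e"
        unfolding u_def using h w_bounds[of s] mult_mono[of h "height_bound a e" "w s" 1] by simp
      ultimately show "s^2 * u s \<le> R2^2 * height_bound a e"
        using h w_bounds[of s] by (intro mult_mono) (auto simp: u_def)
    qed auto
    moreover have "integral {b..r} (\<lambda>_. R2^2 * height_bound a e) \<le> e * (R2^2 * height_bound a e)"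
      using r h mult_right_mono[of "r - b" e "R2^2 * height_bound a e"] by (simp add: ac_simps)
    ultimately have P: "P_fun R1 u r \<le> e * (R2^2 * height_bound a e)" by linarith
    have "2 * (M1 + (M2 - M1) * P_fun R1 u r) / r
        \<le> 2 * (M1 + (M2 - M1) * (e * (R2^2 * height_bound a e))) / a"
    proof (rule frac_le)
      show "2 * (M1 + (M2 - M1) * P_fun R1 u r) \<le> 2 * (M1 + (M2 - M1) * (e * (R2^2 * height_bound a e)))"
        using P M1_less by (simp add: mult_left_mono)
      show "0 \<le> 2 * (M1 + (M2 - M1) * (e * (R2^2 * height_bound a e)))"
        using M1_pos M1_less e h by simp
    qed (use a radius_pos r e in \<open>auto simp: b_def\<close>)
    then show ?thesis by (simp add: F_lower_def F_fun_def)
  qed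
  have "((\<lambda>r. r^3 * max (deriv u r) 0 / sqrt (F_fun M1 M2 R1 u r)) has_integral
      cost_integral M1 M2 R1 R2 u) {R1..R2}"
    unfolding cost_integral_def
    by (intro integrable_integral integrable_continuous_interval cost_integrand_continuous u)
  \<comment> \<open>The majorant keeps only the rising step. Its integral is \<open>K * h\<close>
    however small \<open>e\<close> is, since the step climbs from 0 to 1 within the annulus.\<close>
  moreover have "((\<lambda>r. K * h * (deriv S ((r - b) / e) / e)) has_integral
      K * h * (S ((R2 - b) / e) - S ((R1 - b) / e))) {R1..R2}"
    using R1_less step'
    by (intro has_integral_mult_right fundamental_theorem_of_calculus)
      (auto simp: has_real_derivative_iff_has_vector_derivative[symmetric])
  moreover have "S ((R2 - b) / e) - S ((R1 - b) / e) = 1"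
    using bc e S(3)[of "(R1 - b) / e"] S(4)[of "(R2 - b) / e"]
    by (auto simp: divide_le_0_iff le_divide_eq)
  ultimately have cost: "((\<lambda>r. r^3 * max (deriv u r) 0 / sqrt (F_fun M1 M2 R1 u r)) has_integral
      cost_integral M1 M2 R1 R2 u) {R1..R2}"
    "((\<lambda>r. K * h * (deriv S ((r - b) / e) / e)) has_integral K * h) {R1..R2}"
    by simp_all
  have "cost_integral M1 M2 R1 R2 u \<le> K * h"
  proof (rule has_integral_le[OF cost])
    fix r assume r: "r \<in> {R1..R2}"
    define d where "d = h * (deriv S ((r - b) / e) / e)"
    have "deriv u r \<le> d"
      unfolding u' d_def using h e S(2)[of "(r - c) / e"] by (intro mult_left_mono) auto
    moreover have "0 \<le> d"
      unfolding d_def using h e S(2)[of "(r - b) / e"] by simp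
    ultimately have d: "0 \<le> d" "max (deriv u r) 0 \<le> d" by simp_all
    \<comment> \<open>Where the derivative of the rising step vanishes, so does the positive part of
      \<open>u'\<close>; the weight needs a bound only on \<open>[b, b + e]\<close>.\<close>
    show "r^3 * max (deriv u r) 0 / sqrt (F_fun M1 M2 R1 u r) \<le> K * h * (deriv S ((r - b) / e) / e)"
    proof (cases "deriv S ((r - b) / e) = 0")
      case True
      then have "max (deriv u r) 0 = 0" using d by (simp add: d_def)
      then show ?thesis using True by simp
    next
      case False
      then have r_in: "b \<le> r" "r \<le> b + e"
        using S(5)[OF False] e by (auto simp: field_simps)
      have "r^3 / sqrt (F_fun M1 M2 R1 u r) \<le> K"
        unfolding K_def using F_ge[OF r_in] F r_in r radius_pos
        by (intro frac_le power_mono) (auto simp: b_def)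
      then have "r^3 / sqrt (F_fun M1 M2 R1 u r) * max (deriv u r) 0 \<le> K * d"
        using d K by (intro mult_mono) auto
      then show ?thesis by (simp add: d_def mult.assoc)
    qed
  qed
  also have "\<dots> \<le> K * height_bound a e"
    using K h by (intro mult_left_mono) auto
  finally show thesis using that[OF u] by (simp add: K_def)
qed

text \<open>As \<open>e\<close> tends to 0 the mass enclosed during the rise vanishes and the
  plateau fills \<open>[a, R2]\<close>, so the competitor's cost bound tends to
  \<open>Psi M1 R2 a\<close>.\<close>

lemma exists_cost_less:
  assumes a: "R1 \<le> a" "a < R2" and y: "Psi M1 R2 a < y"
  shows "\<exists>u\<in>admissible R1 R2. cost_integral M1 M2 R1 R2 u < y"
proof -
  have A: "0 < A_fun R2 a" using A_fun_pos a radius_pos by simp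
  have F0: "0 < 1 - 2 * M1 / a" using a radius_pos by simp
  have hb: "((\<lambda>e. height_bound a e) \<longlongrightarrow> 1 / A_fun R2 a) (at_right 0)"
    unfolding height_bound_def A_fun_def using A
    by (auto intro!: tendsto_eq_intros simp: A_fun_def)
  have Fl: "((\<lambda>e. F_lower a e) \<longlongrightarrow> 1 - 2 * M1 / a) (at_right 0)"
    unfolding F_lower_def using a radius_pos by (auto intro!: tendsto_eq_intros hb)
  have "((\<lambda>e. (a + 2 * e)^3 / sqrt (F_lower a e) * height_bound a e) \<longlongrightarrow>
      (a + 2 * 0)^3 / sqrt (1 - 2 * M1 / a) * (1 / A_fun R2 a)) (at_right 0)"
    using F0 by (intro tendsto_intros hb Fl) auto
  moreover have "(a + 2 * 0)^3 / sqrt (1 - 2 * M1 / a) * (1 / A_fun R2 a) = Psi M1 R2 a"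
    using q_fun_eq[OF a(1)] by (simp add: Psi_def)
  ultimately have "\<forall>\<^sub>F e in at_right 0. (a + 2 * e)^3 / sqrt (F_lower a e) * height_bound a e < y"
    using y by (auto dest: order_tendstoD)
  moreover have "\<forall>\<^sub>F e in at_right 0. 0 < F_lower a e"
    using order_tendstoD(1)[OF Fl F0] .
  moreover have "\<forall>\<^sub>F e in at_right (0::real). 0 < e \<and> e < (R2 - a) / 4"
    using eventually_at_right_real[of 0 "(R2 - a) / 4"] a by auto
  ultimately have "\<forall>\<^sub>F e in at_right (0::real). \<exists>u\<in>admissible R1 R2. cost_integral M1 M2 R1 R2 u < y"
  proof eventually_elim
    case (elim e)
    then obtain u where "u \<in> admissible R1 R2"
      "cost_integral M1 M2 R1 R2 u \<le> (a + 2 * e)^3 / sqrt (F_lower a e) * height_bound a e"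
      using competitor[OF a(1), of e] by auto
    with elim show ?case by force
  qed
  \<comment> \<open>The property no longer mentions \<open>e\<close>, and \<open>at_right 0\<close>
    is a nontrivial filter.\<close>
  then show ?thesis by simp
qed

lemma Inf_cost_eq_lambda_star:
  "(INF u\<in>admissible R1 R2. cost_integral M1 M2 R1 R2 u) = lambda_star M1 R1 R2"
proof (rule cInf_eq_non_empty)
  let ?a = "a_opt M1 R1 R2"
  have R2: "2 * M1 < R2" using radius_pos R1_less by simp
  have a: "R1 \<le> ?a" "?a < R2"
    using x0_root[OF M1_pos R2] R1_less by (auto simp: a_opt_def)
  have approx: "\<exists>u\<in>admissible R1 R2. cost_integral M1 M2 R1 R2 u < y"
    if "lambda_star M1 R1 R2 < y" for y
    using exists_cost_less[OF a] that by (simp add: lambda_star_def)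
  \<comment> \<open>The approximating competitors also supply nonemptiness, which the
    characterisation of the real infimum requires.\<close>
  show "cost_integral M1 M2 R1 R2 ` admissible R1 R2 \<noteq> {}"
    using approx[of "lambda_star M1 R1 R2 + 1"] by auto
  show "lambda_star M1 R1 R2 \<le> x" if "x \<in> cost_integral M1 M2 R1 R2 ` admissible R1 R2" for x
  proof -
    have "0 \<le> lambda_star M1 R1 R2"
      using Psi_eq_exp[of M1 ?a R2] a M1_pos radius_pos by (simp add: lambda_star_def)
    then show ?thesis
      using that cost_integral_ge Psi_a_opt_le[OF M1_pos radius_pos(2)]
      by (auto simp: lambda_star_def)
  qed
  \<comment> \<open>A lower bound \<open>y\<close> above \<open>lambda_star\<close> would be
    undercut by some competitor.\<close>
  show "y \<le> lambda_star M1 R1 R2"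
    if y: "\<And>x. x \<in> cost_integral M1 M2 R1 R2 ` admissible R1 R2 \<Longrightarrow> y \<le> x" for y
    using approx[of y] y by (force simp: not_less[symmetric])
qed

end

section \<open>Thin annuli\<close>

text \<open>At \<open>L = 0\<close> the value of the cubic at \<open>R\<close> is
  \<open>3 * R^3 * (R - 2 * M1) > 0\<close>; by continuity in \<open>L\<close> the root eventually
  lies at or below \<open>R\<close>.\<close>

lemma a_opt_eventually:
  assumes "0 < M1" "2 * M1 < R"
  shows "\<forall>\<^sub>F L in at_right 0. a_opt M1 R (R + L) = R"
proof -
  have "((\<lambda>L. cubic M1 (R + L) R) \<longlongrightarrow> 3 * R ^ 3 * (R - 2 * M1)) (at_right 0)"
    unfolding cubic_def by (auto intro!: tendsto_eq_intros) algebra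
  moreover have "0 < 3 * R ^ 3 * (R - 2 * M1)" using assms by simp
  ultimately have "\<forall>\<^sub>F L in at_right 0. 0 < cubic M1 (R + L) R"
    by (rule order_tendstoD)
  then show ?thesis
    using eventually_at_right_less[of 0]
  proof eventually_elim
    case (elim L)
    then show ?case
      using assms x0_le_iff[of M1 "R + L" R] by (simp add: a_opt_def)
  qed
qed

text \<open>Splitting off \<open>r^2\<close> exposes the leading coefficient of
  \<open>lambda_star\<close>, because \<open>1 / A_fun (R + L) R\<close> behaves like
  \<open>1 / (R^2 * L)\<close>.\<close>

lemma q_fun_eq_square_mult:
  assumes "0 < r"
  shows "q_fun M1 r = r powr (3/2) / sqrt (r - 2 * M1) * r^2"
proof -
  have "r powr (7/2) = r powr (3/2 + 2)" by simp
  also have "\<dots> = r powr (3/2) * r^2" using assms by (simp only: powr_add) simp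
  finally show ?thesis by (simp add: q_fun_def)
qed

theorem theorem5p2:
  fixes M1 M2 R :: real
  assumes "0 < M1" and "M1 < M2" and "2 * M2 < R"
  shows "(\<forall>\<^sub>F L in at_right 0. a_opt M1 R (R + L) = R) \<and>
    (\<lambda>L. H_star M1 R (R + L) - 1 / (R^2 * L)) \<in> O[at_right 0](\<lambda>_. 1) \<and>
    (\<lambda>L. lambda_star M1 R (R + L) - R powr (3/2) / sqrt (R - 2 * M1) * (1 / L))
      \<in> O[at_right 0](\<lambda>_. 1) \<and>
    (\<forall>L>0. (M2 - M1) / 2 * lambda_star M1 R (R + L) =
       (M2 - M1) / 2 * (INF u\<in>admissible R (R + L). cost_integral M1 M2 R (R + L) u)) \<and>
    (\<lambda>L. (M2 - M1) / 2 * lambda_star M1 R (R + L)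
        - (M2 - M1) * R powr (3/2) / (2 * sqrt (R - 2 * M1)) * (1 / L))
      \<in> O[at_right 0](\<lambda>_. 1) \<and>
    filterlim (\<lambda>L. (M2 - M1) / 2 *
        (INF u\<in>admissible R (R + L). cost_integral M1 M2 R (R + L) u))
      at_top (at_right 0)"
proof -
  have R: "0 < R" "2 * M1 < R" using assms by auto
  note a_eq = a_opt_eventually[OF assms(1) R(2)]
  define k where "k = R powr (3/2) / sqrt (R - 2 * M1)"
  have k: "0 < k" using R by (simp add: k_def)
  \<comment> \<open>From \<open>(R + L)^3 - R^3 = L * (3 * R^2 + 3 * R * L + L^2)\<close> the
    singular part cancels exactly. What remains has the finite limit
    \<open>- 1 / R^3\<close>.\<close>
  let ?rest = "\<lambda>L. - (3 * R + L) / (R^2 * (3 * R^2 + 3 * R * L + L^2))"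
  have H: "\<forall>\<^sub>F L in at_right 0. H_star M1 R (R + L) - 1 / (R^2 * L) = ?rest L"
    using a_eq eventually_at_right_less[of 0]
  proof eventually_elim
    case (elim L)
    define D where "D = 3 * R^2 + 3 * R * L + L^2"
    have "A_fun (R + L) R = L * D / 3"
      unfolding A_fun_def D_def by algebra
    then have "H_star M1 R (R + L) - 1 / (R^2 * L) = 3 / (L * D) - 1 / (R^2 * L)"
      using elim by (simp only: H_star_def) simp
    moreover have "0 < D"
      using elim R by (simp add: D_def add_pos_pos)
    then have "3 / (L * D) - 1 / (R^2 * L) = (3 * R^2 - D) / (R^2 * D * L)"
      using elim R by (simp add: divide_simps)
    moreover have "3 * R^2 - D = - (3 * R + L) * L"
      unfolding D_def by algebra
    ultimately show ?case using elim by (simp add: D_def)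
  qed
  have "(?rest \<longlongrightarrow> - (3 * R + 0) / (R^2 * (3 * R^2 + 3 * R * 0 + 0^2))) (at_right 0)"
    using R by (intro tendsto_intros) auto
  then have "?rest \<in> O[at_right 0](\<lambda>_. 1)"
    by (intro bigoI_tendsto[where c = "- (3 * R + 0) / (R^2 * (3 * R^2 + 3 * R * 0 + 0^2))"]) auto
  then have H_O: "(\<lambda>L. H_star M1 R (R + L) - 1 / (R^2 * L)) \<in> O[at_right 0](\<lambda>_. 1)"
    using landau_o.big.in_cong[OF H] by blast
  \<comment> \<open>Once \<open>a = R\<close>, \<open>lambda_star\<close> is \<open>k * R^2\<close>
    times \<open>H_star\<close>, so its expansion is a constant multiple of the one just
    proved.\<close>
  have "\<forall>\<^sub>F L in at_right 0. lambda_star M1 R (R + L) - k * (1 / L) =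
      k * R^2 * (H_star M1 R (R + L) - 1 / (R^2 * L))"
    using a_eq
  proof eventually_elim
    case (elim L)
    then show ?case
      using R q_fun_eq_square_mult[OF R(1), of M1]
      by (simp add: lambda_star_def H_star_def Psi_def k_def right_diff_distrib)
  qed
  moreover have "(\<lambda>L. k * R^2 * (H_star M1 R (R + L) - 1 / (R^2 * L))) \<in> O[at_right 0](\<lambda>_. 1)"
    using H_O R k by simp
  ultimately have lam_O: "(\<lambda>L. lambda_star M1 R (R + L) - k * (1 / L)) \<in> O[at_right 0](\<lambda>_. 1)"
    by (rule landau_o.big.in_cong[THEN iffD2])
  have "(\<lambda>L. (M2 - M1) / 2 * (lambda_star M1 R (R + L) - k * (1 / L))) \<in> O[at_right 0](\<lambda>_. 1)"
    using lam_O assms by simp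
  then have phys_O: "(\<lambda>L. (M2 - M1) / 2 * lambda_star M1 R (R + L)
      - (M2 - M1) * R powr (3/2) / (2 * sqrt (R - 2 * M1)) * (1 / L)) \<in> O[at_right 0](\<lambda>_. 1)"
    by (simp add: k_def right_diff_distrib mult.assoc)
  have Inf: "(INF u\<in>admissible R (R + L). cost_integral M1 M2 R (R + L) u) = lambda_star M1 R (R + L)"
    if "0 < L" for L
    using assms that by (intro annulus.Inf_cost_eq_lambda_star annulus.intro) auto
  \<comment> \<open>Divergence is read off the quotient itself: a fixed positive numerator over
    \<open>A_fun (R + L) R\<close>, which tends to 0 from above.\<close>
  have "filterlim (\<lambda>L. (M2 - M1) / 2 * q_fun M1 R / A_fun (R + L) R) at_top (at_right 0)"
  proof (rule LIM_at_top_divide[OF tendsto_const])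
    show "0 < (M2 - M1) / 2 * q_fun M1 R" using assms R by (simp add: q_fun_def)
    show "((\<lambda>L. A_fun (R + L) R) \<longlongrightarrow> 0) (at_right 0)"
      unfolding A_fun_def by (auto intro!: tendsto_eq_intros)
    show "\<forall>\<^sub>F L in at_right 0. 0 < A_fun (R + L) R"
      using R A_fun_pos by (auto simp: eventually_at_filter)
  qed
  moreover have "\<forall>\<^sub>F L in at_right 0. (M2 - M1) / 2 * q_fun M1 R / A_fun (R + L) R =
      (M2 - M1) / 2 * (INF u\<in>admissible R (R + L). cost_integral M1 M2 R (R + L) u)"
    using a_eq eventually_at_right_less[of 0]
    by eventually_elim (simp add: Inf lambda_star_def Psi_def)
  ultimately have "filterlim (\<lambda>L. (M2 - M1) / 2 *
      (INF u\<in>admissible R (R + L). cost_integral M1 M2 R (R + L) u)) at_top (at_right 0)"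
    by (rule filterlim_cong[OF refl refl, THEN iffD1, rotated])
  then show ?thesis
    using a_eq H_O lam_O phys_O Inf by (simp add: k_def)
qed

end
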